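(* Let $A=S+R$, $A_\theta:=S+\theta R$ for $\theta\in[0,1]$, and $$\eta_s(\theta):=(1-\theta)L_s\|R\psi_1(s)\|_\infty.$$ If $p_A(s)\in\arg\max_j z_A(s)_j$ and $$\Delta_A^{\mathrm{pred}}(s):=z_A(s)_{p_A(s)}-\max_{j\ne p_A(s)}z_A(s)_j,$$ then the predicted label at $s$ can change between $A_1$ and $A_\theta$ (i.e. $p_{A_\theta}(s)\neq p_{A_1}(s)$) only if $\Delta_{A_1}^{\mathrm{pred}}(s)\le2\eta_s(\theta)$. For the true-label margin $$\Delta_A^{\mathrm{true}}(s):=z_A(s)_{C(s)}-\max_{j\ne C(s)}z_A(s)_j,$$ one has $$\big|\operatorname{acc}_{A_\theta}(T)-\operatorname{acc}_{A_1}(T)\big|\le\frac1{|T|}\#\left\{s\in T:\left|\Delta_{A_1}^{\mathrm{true}}(s)\right|\le2\eta_s(\theta)\right\},$$ where $\operatorname{acc}_A(T):=\frac1{|T|}\#\{s\in T:\Delta_A^{\mathrm{true}}(s)>0\}$.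
   Context: $T$ is a finite nonempty training set with correct classes $C(s)\in\{1,\dots,K\}$, $K\ge2$. A target layer $A\in\mathbb R^{n\times m}$ sits inside a network whose logits are $z_A(s):=\psi_2(A\psi_1(s))\in\mathbb R^K$, where $\psi_1$ (values in $\mathbb R^m$) and $\psi_2:\mathbb R^n\to\mathbb R^K$ are the pre- and post-layer maps with all other parameters frozen. For $A=S+R$ and $A_\theta=S+\theta R$, $L_s\ge0$ is any finite upper bound on the local $\ell_\infty$-Lipschitz constant of $\psi_2$ on $\{A_\theta\psi_1(s):0\le\theta\le1\}$, i.e. $\|\psi_2(v)-\psi_2(w)\|_\infty\le L_s\|v-w\|_\infty$ for all $v,w$ in this set. $\|\cdot\|_\infty$ is the vector maximum norm. *)

theory Defs
  imports "HOL-Analysis.Analysis"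
begin

text \<open>
  The class labels 1, ..., K are rendered as a finite index type of cardinality K, and
  a logit vector as an element of the K-dimensional space over that type. The maximum norm is
  \<^const>\<open>infnorm\<close> (see \<open>infnorm_cart\<close>). The part of the network outside the target
  layer enters only through the pre- and post-layer maps \<open>\<psi>1\<close> and \<open>\<psi>2\<close>.
\<close>

definition logits ::
    "('s \<Rightarrow> real^'m) \<Rightarrow> (real^'n \<Rightarrow> real^'k) \<Rightarrow> real^'m^'n \<Rightarrow> 's \<Rightarrow> real^'k"
  where "logits \<psi>1 \<psi>2 A s = \<psi>2 (A *v \<psi>1 s)"

definition layer_path :: "real^'m^'n \<Rightarrow> real^'m^'n \<Rightarrow> real \<Rightarrow> real^'m^'n"
  where "layer_path S R \<theta> = S + \<theta> *\<^sub>R R"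

text \<open>The maximum below ranges over a nonempty set only if there are at least two classes.\<close>

definition margin :: "real^'k \<Rightarrow> 'k \<Rightarrow> real"
  where "margin z c = z $ c - Max ((\<lambda>j. z $ j) ` {j. j \<noteq> c})"

text \<open>
  A prediction rule: every choice of a maximizing class is allowed, so ties between the
  logits may be broken arbitrarily, also differently for different layers and samples.
\<close>

definition prediction_rule ::
    "('s \<Rightarrow> real^'m) \<Rightarrow> (real^'n \<Rightarrow> real^'k) \<Rightarrow> 's set \<Rightarrow> (real^'m^'n \<Rightarrow> 's \<Rightarrow> 'k) \<Rightarrow> bool"
  where "prediction_rule \<psi>1 \<psi>2 T p \<longleftrightarrow>
    (\<forall>A. \<forall>s\<in>T. is_arg_max (\<lambda>j. logits \<psi>1 \<psi>2 A s $ j) (\<lambda>_. True) (p A s))"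

definition pred_margin ::
    "('s \<Rightarrow> real^'m) \<Rightarrow> (real^'n \<Rightarrow> real^'k) \<Rightarrow> (real^'m^'n \<Rightarrow> 's \<Rightarrow> 'k) \<Rightarrow> real^'m^'n \<Rightarrow> 's \<Rightarrow> real"
  where "pred_margin \<psi>1 \<psi>2 p A s = margin (logits \<psi>1 \<psi>2 A s) (p A s)"

definition true_margin ::
    "('s \<Rightarrow> real^'m) \<Rightarrow> (real^'n \<Rightarrow> real^'k) \<Rightarrow> ('s \<Rightarrow> 'k) \<Rightarrow> real^'m^'n \<Rightarrow> 's \<Rightarrow> real"
  where "true_margin \<psi>1 \<psi>2 C A s = margin (logits \<psi>1 \<psi>2 A s) (C s)"

definition accuracy ::
    "('s \<Rightarrow> real^'m) \<Rightarrow> (real^'n \<Rightarrow> real^'k) \<Rightarrow> ('s \<Rightarrow> 'k) \<Rightarrow> 's set \<Rightarrow> real^'m^'n \<Rightarrow> real"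
  where "accuracy \<psi>1 \<psi>2 C T A =
    1 / real (card T) * real (card {s \<in> T. true_margin \<psi>1 \<psi>2 C A s > 0})"

text \<open>
  The library's \<^const>\<open>lipschitz_on\<close> is not usable here: on the vector type it refers to the
  Euclidean distance, not to the maximum norm.
\<close>

definition linf_lipschitz_bound :: "(real^'n \<Rightarrow> real^'k) \<Rightarrow> (real^'n) set \<Rightarrow> real \<Rightarrow> bool"
  where "linf_lipschitz_bound f X L \<longleftrightarrow>
    0 \<le> L \<and> (\<forall>v\<in>X. \<forall>w\<in>X. infnorm (f v - f w) \<le> L * infnorm (v - w))"

definition perturbation_bound ::
    "('s \<Rightarrow> real^'m) \<Rightarrow> real^'m^'n \<Rightarrow> ('s \<Rightarrow> real) \<Rightarrow> 's \<Rightarrow> real \<Rightarrow> real"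
  where "perturbation_bound \<psi>1 R L s \<theta> = (1 - \<theta>) * L s * infnorm (R *v \<psi>1 s)"

end

theory Submission
  imports Defs
begin

text \<open>Moving the layer from parameter 1 to \<theta> shifts the input of \<open>\<psi>2\<close>
  by a multiple 1 - \<theta> of \<open>R *v \<psi>1 s\<close>, so the Lipschitz bound moves each
  logit by at most \<eta> (\<open>infnorm_logits_layer_path_diff_le\<close>). A gap between two
  logits then moves by at most 2\<eta>. If another class wins at \<theta>, its gap to the old label
  was at most 2\<eta> at parameter 1 (\<open>margin_le_if_arg_max_differs\<close>). The true margin
  also moves by at most 2\<eta> (\<open>abs_margin_diff_le\<close>), so its positivity can change
  only at samples where it was within 2\<eta> of zero; counting these bounds the change of accuracy
  (\<open>abs_card_diff_le\<close>).\<close>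

lemma component_diff_le_infnorm:
  fixes z w :: "real^'k"
  shows "\<bar>z $ i - w $ i\<bar> \<le> infnorm (z - w)"
  using component_le_infnorm_cart[of "z - w" i] by simp

lemma margin_le_component_diff:
  fixes z :: "real^'k::finite"
  assumes "j \<noteq> c"
  shows "margin z c \<le> z $ c - z $ j"
  using assms by (simp add: margin_def)

text \<open>With two classes the set of competitors is nonempty, so \<open>Max\<close> is attained
  and a margin can be treated as a gap to one named runner-up.\<close>

lemma margin_attained:
  fixes z :: "real^'k::finite"
  assumes "CARD('k) \<ge> 2"
  obtains j where "j \<noteq> c" "margin z c = z $ c - z $ j"
proof -
  have "UNIV \<noteq> {c}"
    using assms by (metis card_1_singleton_iff One_nat_def Suc_1 not_less_eq_eq order_refl)
  then have "{j. j \<noteq> c} \<noteq> {}"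
    by blast
  then have "Max ((\<lambda>j. z $ j) ` {j. j \<noteq> c}) \<in> (\<lambda>j. z $ j) ` {j. j \<noteq> c}"
    by (intro Max_in) auto
  then show thesis
    using that by (auto simp: margin_def)
qed

text \<open>The runner-up \<open>j\<close> of \<open>w\<close> is an admissible competitor for
  \<open>z\<close>, so no two maxima need comparing. The factor 2 counts the coordinates
  \<open>c\<close> and \<open>j\<close>.\<close>

lemma margin_diff_le:
  fixes z w :: "real^'k::finite"
  assumes "CARD('k) \<ge> 2"
  shows "margin z c - margin w c \<le> 2 * infnorm (z - w)"
proof -
  obtain j where j: "j \<noteq> c" "margin w c = w $ c - w $ j"
    using margin_attained[OF assms] .
  have "margin z c \<le> z $ c - z $ j"
    using j(1) by (rule margin_le_component_diff)
  then show ?thesis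
    using j(2) component_diff_le_infnorm[of z c w] component_diff_le_infnorm[of z j w] by linarith
qed

lemma abs_margin_diff_le:
  fixes z w :: "real^'k::finite"
  assumes "CARD('k) \<ge> 2"
  shows "\<bar>margin z c - margin w c\<bar> \<le> 2 * infnorm (z - w)"
  using margin_diff_le[OF assms, of z c w] margin_diff_le[OF assms, of w c z]
  by (simp add: infnorm_sub abs_le_iff)

text \<open>The gap from \<open>c\<close> to \<open>q\<close> is at most 0 in \<open>w\<close>;
  passing to \<open>z\<close> costs one norm for each of the two coordinates.\<close>

lemma margin_le_if_arg_max_differs:
  fixes z w :: "real^'k::finite"
  assumes "is_arg_max (\<lambda>j. w $ j) (\<lambda>_. True) q" "q \<noteq> c"
  shows "margin z c \<le> 2 * infnorm (z - w)"
proof -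
  have "w $ c \<le> w $ q"
    using assms(1) by (auto simp: is_arg_max_def not_less)
  then show ?thesis
    using margin_le_component_diff[OF assms(2), of z]
      component_diff_le_infnorm[of z c w] component_diff_le_infnorm[of z q w] by linarith
qed

text \<open>The points with parameters 1 and \<theta> both lie on the segment where the Lipschitz
  bound holds, and their difference is explicit because the path is affine in its parameter.\<close>

lemma infnorm_logits_layer_path_diff_le:
  fixes S R :: "real^'m::finite^'n::finite" and \<psi>2 :: "real^'n \<Rightarrow> real^'k::finite"
  assumes "linf_lipschitz_bound \<psi>2 ((\<lambda>t. layer_path S R t *v \<psi>1 s) ` {0..1}) (L s)"
    and "\<theta> \<in> {0..1}"
  shows "infnorm (logits \<psi>1 \<psi>2 (layer_path S R 1) s - logits \<psi>1 \<psi>2 (layer_path S R \<theta>) s)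
    \<le> perturbation_bound \<psi>1 R L s \<theta>"
proof -
  have "layer_path S R 1 *v \<psi>1 s - layer_path S R \<theta> *v \<psi>1 s = (1 - \<theta>) *\<^sub>R (R *v \<psi>1 s)"
    by (simp add: layer_path_def matrix_vector_mult_add_rdistrib
        scaleR_matrix_vector_assoc[symmetric] algebra_simps)
  \<comment> \<open>The absolute value from \<open>infnorm_mul\<close> drops since \<theta> is at
    most 1.\<close>
  then have "infnorm (layer_path S R 1 *v \<psi>1 s - layer_path S R \<theta> *v \<psi>1 s)
      = (1 - \<theta>) * infnorm (R *v \<psi>1 s)"
    using assms(2) by (simp add: infnorm_mul)
  moreover have "infnorm (logits \<psi>1 \<psi>2 (layer_path S R 1) s - logits \<psi>1 \<psi>2 (layer_path S R \<theta>) s)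
      \<le> L s * infnorm (layer_path S R 1 *v \<psi>1 s - layer_path S R \<theta> *v \<psi>1 s)"
    using assms unfolding linf_lipschitz_bound_def logits_def by auto
  ultimately show ?thesis
    by (simp add: perturbation_bound_def mult_ac)
qed

text \<open>\<open>D\<close> covers the symmetric difference, so each set lies in the union of the
  other with \<open>D\<close>.\<close>

lemma abs_card_diff_le:
  assumes "finite D" "A - B \<subseteq> D" "B - A \<subseteq> D" "finite A" "finite B"
  shows "\<bar>real (card A) - real (card B)\<bar> \<le> real (card D)"
proof -
  have "card A \<le> card B + card D" if "A - B \<subseteq> D" "finite B" for A B
  proof -
    have "card A \<le> card (B \<union> D)"
      using that assms(1) by (intro card_mono) auto
    also have "\<dots> \<le> card B + card D"
      by (rule card_Un_le)
    finally show ?thesis .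
  qed
  from this[OF assms(2,5)] this[OF assms(3,4)] show ?thesis
    by linarith
qed

theorem corollary5p2:
  fixes T :: "'s set"
    and C :: "'s \<Rightarrow> 'k::finite"
    and \<psi>1 :: "'s \<Rightarrow> real^'m::finite"
    and \<psi>2 :: "real^'n::finite \<Rightarrow> real^'k"
    and S R :: "real^'m^'n"
    and L :: "'s \<Rightarrow> real"
    and p :: "real^'m^'n \<Rightarrow> 's \<Rightarrow> 'k"
    and \<theta> :: real
  assumes "finite T" and "T \<noteq> {}"
    and "CARD('k) \<ge> 2"
    and "\<And>s. s \<in> T \<Longrightarrow>
      linf_lipschitz_bound \<psi>2 ((\<lambda>t. layer_path S R t *v \<psi>1 s) ` {0..1}) (L s)"
    and "prediction_rule \<psi>1 \<psi>2 T p"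
    and "\<theta> \<in> {0..1}"
  shows "(\<forall>s\<in>T. p (layer_path S R \<theta>) s \<noteq> p (layer_path S R 1) s \<longrightarrow>
           pred_margin \<psi>1 \<psi>2 p (layer_path S R 1) s \<le> 2 * perturbation_bound \<psi>1 R L s \<theta>)
    \<and> \<bar>accuracy \<psi>1 \<psi>2 C T (layer_path S R \<theta>) - accuracy \<psi>1 \<psi>2 C T (layer_path S R 1)\<bar>
       \<le> 1 / real (card T) *
          real (card {s \<in> T. \<bar>true_margin \<psi>1 \<psi>2 C (layer_path S R 1) s\<bar>
                               \<le> 2 * perturbation_bound \<psi>1 R L s \<theta>})"
proof -
  define z where "z t s = logits \<psi>1 \<psi>2 (layer_path S R t) s" for t s
  define \<eta> where "\<eta> s = perturbation_bound \<psi>1 R L s \<theta>" for s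
  have close: "infnorm (z 1 s - z \<theta> s) \<le> \<eta> s" if "s \<in> T" for s
    unfolding z_def \<eta>_def using assms(4)[OF that] assms(6)
    by (rule infnorm_logits_layer_path_diff_le)
  have pred: "pred_margin \<psi>1 \<psi>2 p (layer_path S R 1) s \<le> 2 * \<eta> s"
    if "s \<in> T" "p (layer_path S R \<theta>) s \<noteq> p (layer_path S R 1) s" for s
  proof -
    \<comment> \<open>Tie-breaking is harmless: the new label only has to score at least as high as
      the old one at \<theta>.\<close>
    have "is_arg_max (\<lambda>j. z \<theta> s $ j) (\<lambda>_. True) (p (layer_path S R \<theta>) s)"
      using assms(5) that(1) by (simp add: prediction_rule_def z_def)
    from margin_le_if_arg_max_differs[OF this that(2), of "z 1 s"] close[OF that(1)]
    show ?thesis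
      by (simp add: pred_margin_def z_def)
  qed
  define P where "P t = {s \<in> T. true_margin \<psi>1 \<psi>2 C (layer_path S R t) s > 0}" for t
  define D where "D = {s \<in> T. \<bar>true_margin \<psi>1 \<psi>2 C (layer_path S R 1) s\<bar> \<le> 2 * \<eta> s}"
  have diff: "\<bar>true_margin \<psi>1 \<psi>2 C (layer_path S R 1) s
      - true_margin \<psi>1 \<psi>2 C (layer_path S R \<theta>) s\<bar> \<le> 2 * \<eta> s" if "s \<in> T" for s
    using abs_margin_diff_le[OF assms(3), of "z 1 s" "C s" "z \<theta> s"] close[OF that]
    by (simp add: true_margin_def z_def)
  \<comment> \<open>If exactly one of the two margins is positive, zero separates them weakly, so
    the absolute value of the one at parameter 1 is at most their distance.\<close>
  have "P \<theta> - P 1 \<subseteq> D" "P 1 - P \<theta> \<subseteq> D"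
    using diff by (fastforce simp: P_def D_def)+
  then have "\<bar>real (card (P \<theta>)) - real (card (P 1))\<bar> \<le> real (card D)"
    using assms(1) by (intro abs_card_diff_le) (auto simp: P_def D_def)
  then have "\<bar>1 / real (card T) * real (card (P \<theta>)) - 1 / real (card T) * real (card (P 1))\<bar>
      \<le> 1 / real (card T) * real (card D)"
    unfolding right_diff_distrib[symmetric] abs_mult by (simp add: divide_right_mono)
  then show ?thesis
    using pred unfolding accuracy_def P_def D_def \<eta>_def by blast
qed

end
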